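(* Let $\mathcal{C}$ be a finitely aligned left cancellative small category, and let $T\colon\mathcal{C}\to B$ be a representation of $\mathcal{C}$ in a $C^*$-algebra $B$. If $T$ is tight, then it is covariant. On the other hand, if $T$ is nondegenerate and covariant, then it is tight.
   Context: Small categories: a small category $\mathcal{C}$ is identified with its set of morphisms; $\mathcal{C}^0\subseteq\mathcal{C}$ (nonempty) is the set of vertices (objects, identified with identity morphisms), $r,s\colon\mathcal{C}\to\mathcal{C}^0$ are the range and source maps, and $\alpha\beta$ is defined iff $s(\alpha)=r(\beta)$. $\mathcal{C}$ is left cancellative if $\alpha\beta=\alpha\gamma$ implies $\beta=\gamma$. Write $\alpha\mathcal{C}=\{\alpha\beta: r(\beta)=s(\alpha)\}$ and, for $v\in\mathcal{C}^0$, $v\mathcal{C}=r^{-1}(v)$. $\mathcal{C}$ is finitely aligned if for all $\alpha,\beta\in\mathcal{C}$ there is a finite (possibly empty) $F\subseteq\mathcal{C}$ with $\alpha\mathcal{C}\cap\beta\mathcal{C}=\bigcup_{\gamma\in F}\gamma\mathcal{C}$. A set $F$ is independent if $\gamma\notin\gamma'\mathcal{C}$ for all distinct $\gamma,\gamma'\in F$. One writes $\alpha\vee\beta$ for any finite independent $F$ with $\alpha\mathcal{C}\cap\beta\mathcal{C}=\bigcup_{\gamma\in F}\gamma\mathcal{C}$; it is unique up to replacing elements $\gamma$ by $\gamma\delta$ with $\delta$ invertible. A subset $F\subseteq v\mathcal{C}$ is exhaustive at $v\in\mathcal{C}^0$ if for every $\alpha\in v\mathcal{C}$ there is $\beta\in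 F$ with $\alpha\mathcal{C}\cap\beta\mathcal{C}\neq\varnothing$. Representations: a representation of $\mathcal{C}$ in a $C^*$-algebra $B$ is a map $T\colon\mathcal{C}\to B$ such that for all $\alpha,\beta\in\mathcal{C}$: (1) $T_\alpha^*T_\alpha=T_{s(\alpha)}$; (2) $T_\alpha T_\beta=T_{\alpha\beta}$ if $s(\alpha)=r(\beta)$; (3) $T_\alpha T_\alpha^*T_\beta T_\beta^*=\bigvee_{\gamma\in\alpha\vee\beta}T_\gamma T_\gamma^*$. $T$ is covariant if moreover (4) $T_v=\bigvee_{\alpha\in F}T_\alpha T_\alpha^*$ for every $v\in\mathcal{C}^0$ and every finite exhaustive set $F$ at $v$. Joins of projections are a priori taken in $B^{**}$; the empty join is $0$. $T$ is nondegenerate if $\sum_{v\in\mathcal{C}^0}T_v$ converges strictly to $1$ in the multiplier algebra $M(B)$. Tightness: for $L\subseteq\mathcal{C}$, a subset $H\subseteq L$ is a covering of $L$ if for every $\alpha\in L$ there is $\beta\in H$ with $\alpha\mathcal{C}\cap\beta\mathcal{C}\neq\varnothing$. For finite $F,K\subseteq\mathcal{C}$ set $$\mathcal{C}^{F,K}=\Big(\bigcap_{\beta\in F}s(\beta)\mathcal{C}\Big)\cap\Big(\bigcap_{\gamma\in K}\mathcal{C}\setminus s(\gamma)\mathcal{C}\Big)$$ (an empty intersection being $\mathcal{C}$). $T$ is tight if for every pair of finite subsets $F,K\subseteq\mathcal{C}$ and every finite covering $H$ of $\mathcal{C}^{F,K}$, $$\bigvee_{\alpha\in H}T_\alpha T_\alpha^*=\prod_{\beta\in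 F}T_\beta^*T_\beta\prod_{\gamma\in K}(1-T_\gamma^*T_\gamma),$$ where $1$ is the unit of $M(B)$ (empty products are $1$). *)

theory Defs
  imports "HOL-Analysis.Analysis"
begin

section \<open>Complex normed spaces and C*-algebras\<close>

class complex_normed_vector = real_normed_vector +
  fixes scaleC :: "complex \<Rightarrow> 'a \<Rightarrow> 'a" (infixr \<open>*\<^sub>C\<close> 75)
  assumes scaleC_add_right: "c *\<^sub>C (x + y) = c *\<^sub>C x + c *\<^sub>C y"
    and scaleC_add_left: "(c + d) *\<^sub>C x = c *\<^sub>C x + d *\<^sub>C x"
    and scaleC_scaleC: "c *\<^sub>C (d *\<^sub>C x) = (c * d) *\<^sub>C x"
    and scaleC_of_real: "of_real r *\<^sub>C x = r *\<^sub>R x"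
    and norm_scaleC: "norm (c *\<^sub>C x) = cmod c * norm x"

instantiation complex :: complex_normed_vector
begin

definition scaleC_complex :: "complex \<Rightarrow> complex \<Rightarrow> complex"
  where "scaleC_complex c z = c * z"

instance
  by standard (simp_all add: scaleC_complex_def algebra_simps norm_mult scaleR_conv_of_real)

end

text \<open>No unit is required, and the zero algebra is allowed.\<close>

class cstar_algebra = complex_normed_vector + real_normed_algebra + banach +
  fixes adj :: "'a \<Rightarrow> 'a"
  assumes mult_scaleC_left: "(c *\<^sub>C x) * y = c *\<^sub>C (x * y)"
    and mult_scaleC_right: "x * (c *\<^sub>C y) = c *\<^sub>C (x * y)"
    and adj_adj: "adj (adj x) = x"
    and adj_add: "adj (x + y) = adj x + adj y"
    and adj_scaleC: "adj (c *\<^sub>C x) = cnj c *\<^sub>C adj x"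
    and adj_mult: "adj (x * y) = adj y * adj x"
    and cstar_identity: "norm (adj x * x) = (norm x)\<^sup>2"

definition cbounded_linear ::
    "('a::complex_normed_vector \<Rightarrow> 'b::complex_normed_vector) \<Rightarrow> bool"
  where "cbounded_linear f \<longleftrightarrow> bounded_linear f \<and> (\<forall>c x. f (c *\<^sub>C x) = c *\<^sub>C f x)"

lemma cbounded_linearI:
  assumes "\<And>x y. f (x + y) = f x + f y"
    and "\<And>c x. f (c *\<^sub>C x) = c *\<^sub>C f x"
    and "\<And>x. norm (f x) \<le> norm x * K"
  shows "cbounded_linear f"
proof -
  have "f (r *\<^sub>R x) = r *\<^sub>R f x" for r x
    using assms(2)[of "of_real r" x] by (simp add: scaleC_of_real)
  then show ?thesis
    unfolding cbounded_linear_def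
    using bounded_linear_intro[of f K] assms by blast
qed

lemma norm_adj: "norm (adj x) = norm (x::'a::cstar_algebra)"
proof -
  have le: "norm y \<le> norm (adj y)" for y :: 'a
  proof (cases "y = 0")
    case False
    have "norm y * norm y \<le> norm (adj y) * norm y"
      using norm_mult_ineq[of "adj y" y] cstar_identity[of y] by (simp add: power2_eq_square)
    with False show ?thesis by simp
  qed simp
  from le[of x] le[of "adj x"] show ?thesis by (simp add: adj_adj)
qed


section \<open>The dual space\<close>

typedef (overloaded) 'a cdual = "{f :: 'a::complex_normed_vector \<Rightarrow> complex. cbounded_linear f}"
  morphisms cdual_apply Cdual
  by (rule exI[of _ "\<lambda>x. 0"]) (auto intro!: cbounded_linearI[where K=0] simp: scaleC_complex_def)

setup_lifting type_definition_cdual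

lemma cdual_eqI: "(\<And>x. cdual_apply f x = cdual_apply g x) \<Longrightarrow> f = g"
  by transfer auto

instantiation cdual :: (complex_normed_vector) complex_normed_vector
begin

lift_definition norm_cdual :: "'a cdual \<Rightarrow> real" is onorm .

lift_definition minus_cdual :: "'a cdual \<Rightarrow> 'a cdual \<Rightarrow> 'a cdual" is "\<lambda>f g x. f x - g x"
  by (auto simp: cbounded_linear_def scaleC_complex_def bounded_linear_sub algebra_simps)

lift_definition plus_cdual :: "'a cdual \<Rightarrow> 'a cdual \<Rightarrow> 'a cdual" is "\<lambda>f g x. f x + g x"
  by (auto simp: cbounded_linear_def scaleC_complex_def bounded_linear_add algebra_simps)

lift_definition uminus_cdual :: "'a cdual \<Rightarrow> 'a cdual" is "\<lambda>f x. - f x"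
  by (auto simp: cbounded_linear_def scaleC_complex_def bounded_linear_minus)

lift_definition zero_cdual :: "'a cdual" is "\<lambda>x. 0"
  by (auto simp: cbounded_linear_def scaleC_complex_def)

lift_definition scaleR_cdual :: "real \<Rightarrow> 'a cdual \<Rightarrow> 'a cdual" is "\<lambda>r f x. r *\<^sub>R f x"
  by (auto simp: cbounded_linear_def scaleC_complex_def bounded_linear_const_scaleR)

lift_definition scaleC_cdual :: "complex \<Rightarrow> 'a cdual \<Rightarrow> 'a cdual" is "\<lambda>c f x. c *\<^sub>C f x"
  by (auto simp: cbounded_linear_def scaleC_complex_def bounded_linear_const_mult)

definition dist_cdual :: "'a cdual \<Rightarrow> 'a cdual \<Rightarrow> real"
  where "dist_cdual f g = norm (f - g)"

definition uniformity_cdual :: "('a cdual \<times> 'a cdual) filter"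
  where "uniformity_cdual = (INF e\<in>{0 <..}. principal {(f, g). dist f g < e})"

definition open_cdual :: "'a cdual set \<Rightarrow> bool"
  where "open_cdual S = (\<forall>f\<in>S. \<forall>\<^sub>F (f', g) in uniformity. f' = f \<longrightarrow> g \<in> S)"

definition sgn_cdual :: "'a cdual \<Rightarrow> 'a cdual"
  where "sgn_cdual f = inverse (norm f) *\<^sub>R f"

instance
proof
  fix f g h :: "'a cdual" and r s :: real and c d :: complex
  show "norm (c *\<^sub>C f) = cmod c * norm f"
  proof (transfer, goal_cases)
    case (1 c f)
    then have bl: "bounded_linear f" by (simp add: cbounded_linear_def)
    have "onorm (\<lambda>x. c * f x) = onorm (\<lambda>x. cmod c *\<^sub>R f x)"
      by (simp add: onorm_def norm_mult)
    then show ?case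
      using onorm_scaleR[OF bl, of "cmod c"] by (simp add: scaleC_complex_def)
  qed
  show "(norm f = 0) = (f = 0)"
    by transfer (auto simp: cbounded_linear_def onorm_eq_0)
  show "norm (f + g) \<le> norm f + norm g"
    by transfer (auto simp: cbounded_linear_def onorm_triangle)
  show "norm (r *\<^sub>R f) = \<bar>r\<bar> * norm f"
    by transfer (auto simp: cbounded_linear_def onorm_scaleR)
qed (simp_all add: dist_cdual_def uniformity_cdual_def open_cdual_def sgn_cdual_def,
    (transfer, force simp: scaleC_complex_def scaleR_conv_of_real algebra_simps)+)

end

lemma cdual_add: "cdual_apply f (x + y) = cdual_apply f x + cdual_apply f y"
  by transfer (auto simp: cbounded_linear_def linear_simps)

lemma cdual_scaleC: "cdual_apply f (c *\<^sub>C x) = c * cdual_apply f x"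
  by transfer (auto simp: cbounded_linear_def scaleC_complex_def)

lemma cdual_norm: "cmod (cdual_apply f x) \<le> norm f * norm x"
  by transfer (auto simp: cbounded_linear_def onorm)

lemma cdual_norm_bound:
  "0 \<le> K \<Longrightarrow> (\<And>x. cmod (cdual_apply f x) \<le> K * norm x) \<Longrightarrow> norm f \<le> K"
  by transfer (rule onorm_bound)


section \<open>The bidual as an involutive algebra\<close>

type_synonym 'a bidual = "'a cdual cdual"

lift_definition to_bidual :: "'a::complex_normed_vector \<Rightarrow> 'a bidual"
  is "\<lambda>x f. cdual_apply f x"
  subgoal for x
    by (rule cbounded_linearI[where K="norm x"])
      (simp_all add: plus_cdual.rep_eq scaleC_cdual.rep_eq cdual_norm)
  done

text \<open>
  The product is the first Arens product,
  \<open>(P Q)(f) = P(Q f)\<close>, \<open>(Q f)(a) = Q(f a)\<close>, \<open>(f a)(b) = f(a b)\<close>.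
  For a C*-algebra \<open>B\<close> it agrees with the second Arens product, and makes \<open>B**\<close>
  the enveloping von Neumann algebra of \<open>B\<close>.
\<close>

lift_definition dual_right_act :: "'a::cstar_algebra cdual \<Rightarrow> 'a \<Rightarrow> 'a cdual"
  is "\<lambda>f a b. cdual_apply f (a * b)"
  subgoal for f a
    using order_trans[OF cdual_norm[of f] mult_left_mono[OF norm_mult_ineq[of a] norm_ge_zero[of f]]]
    by (intro cbounded_linearI[where K="norm f * norm a"])
      (auto simp: cdual_add cdual_scaleC mult_scaleC_right scaleC_complex_def algebra_simps)
  done

lemma norm_dual_right_act: "norm (dual_right_act f a) \<le> norm f * norm a"
proof (rule cdual_norm_bound)
  fix x
  show "cmod (cdual_apply (dual_right_act f a) x) \<le> norm f * norm a * norm x"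
    using order_trans[OF cdual_norm[of f "a * x"]
        mult_left_mono[OF norm_mult_ineq[of a x] norm_ge_zero[of f]]]
    by (simp add: dual_right_act.rep_eq mult.assoc)
qed simp

lift_definition bidual_act :: "'a::cstar_algebra bidual \<Rightarrow> 'a cdual \<Rightarrow> 'a cdual"
  is "\<lambda>Q f a. cdual_apply Q (dual_right_act f a)"
  subgoal for Q f
  proof (rule cbounded_linearI[where K="norm Q * norm f"])
    fix x y :: 'a and c :: complex
    have "dual_right_act f (x + y) = dual_right_act f x + dual_right_act f y"
      by (rule cdual_eqI) (simp add: dual_right_act.rep_eq plus_cdual.rep_eq distrib_right cdual_add)
    then show "cdual_apply Q (dual_right_act f (x + y)) =
        cdual_apply Q (dual_right_act f x) + cdual_apply Q (dual_right_act f y)"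
      by (simp add: cdual_add)
    have "dual_right_act f (c *\<^sub>C x) = c *\<^sub>C dual_right_act f x"
      by (rule cdual_eqI)
        (simp add: dual_right_act.rep_eq scaleC_cdual.rep_eq mult_scaleC_left cdual_scaleC
          scaleC_complex_def)
    then show "cdual_apply Q (dual_right_act f (c *\<^sub>C x)) =
        c *\<^sub>C cdual_apply Q (dual_right_act f x)"
      by (simp add: cdual_scaleC scaleC_complex_def)
    show "cmod (cdual_apply Q (dual_right_act f x)) \<le> norm x * (norm Q * norm f)"
      using order_trans[OF cdual_norm[of Q "dual_right_act f x"]
          mult_left_mono[OF norm_dual_right_act[of f x] norm_ge_zero[of Q]]]
      by (simp add: algebra_simps)
  qed
  done

lemma norm_bidual_act: "norm (bidual_act Q f) \<le> norm Q * norm f"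
proof (rule cdual_norm_bound)
  fix x
  show "cmod (cdual_apply (bidual_act Q f) x) \<le> norm Q * norm f * norm x"
    using order_trans[OF cdual_norm[of Q "dual_right_act f x"]
        mult_left_mono[OF norm_dual_right_act[of f x] norm_ge_zero[of Q]]]
    by (simp add: bidual_act.rep_eq mult.assoc)
qed simp

lift_definition bidual_mult ::
    "'a::cstar_algebra bidual \<Rightarrow> 'a bidual \<Rightarrow> 'a bidual" (infixl \<open>\<odot>\<close> 70)
  is "\<lambda>P Q f. cdual_apply P (bidual_act Q f)"
  subgoal for P Q
  proof (rule cbounded_linearI[where K="norm P * norm Q"])
    fix f g :: "'a cdual" and c :: complex
    have "dual_right_act (f + g) a = dual_right_act f a + dual_right_act g a" for a
      by (rule cdual_eqI) (simp add: dual_right_act.rep_eq plus_cdual.rep_eq)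
    then have "bidual_act Q (f + g) = bidual_act Q f + bidual_act Q g"
      by (intro cdual_eqI) (simp add: bidual_act.rep_eq plus_cdual.rep_eq cdual_add)
    then show "cdual_apply P (bidual_act Q (f + g)) =
        cdual_apply P (bidual_act Q f) + cdual_apply P (bidual_act Q g)"
      by (simp add: cdual_add)
    have "dual_right_act (c *\<^sub>C f) a = c *\<^sub>C dual_right_act f a" for a
      by (rule cdual_eqI) (simp add: dual_right_act.rep_eq scaleC_cdual.rep_eq)
    then have "bidual_act Q (c *\<^sub>C f) = c *\<^sub>C bidual_act Q f"
      by (intro cdual_eqI)
        (simp add: bidual_act.rep_eq scaleC_cdual.rep_eq cdual_scaleC scaleC_complex_def)
    then show "cdual_apply P (bidual_act Q (c *\<^sub>C f)) = c *\<^sub>C cdual_apply P (bidual_act Q f)"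
      by (simp add: cdual_scaleC scaleC_complex_def)
    show "cmod (cdual_apply P (bidual_act Q f)) \<le> norm f * (norm P * norm Q)"
      using order_trans[OF cdual_norm[of P "bidual_act Q f"]
          mult_left_mono[OF norm_bidual_act[of Q f] norm_ge_zero[of P]]]
      by (simp add: algebra_simps)
  qed
  done

text \<open>The involution: \<open>f*(a) = cnj (f(a* ))\<close> on the dual and \<open>P*(f) = cnj (P(f* ))\<close> on the bidual.\<close>

lift_definition dual_adj :: "'a::cstar_algebra cdual \<Rightarrow> 'a cdual"
  is "\<lambda>f a. cnj (cdual_apply f (adj a))"
  subgoal for f
  proof (rule cbounded_linearI[where K="norm f"])
    show "cmod (cnj (cdual_apply f (adj x))) \<le> norm x * norm f" for x
      using cdual_norm[of f "adj x"] by (simp add: norm_adj mult.commute)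
  qed (simp_all add: adj_add adj_scaleC cdual_add cdual_scaleC scaleC_complex_def)
  done

lemma norm_dual_adj: "norm (dual_adj f) \<le> norm f"
proof (rule cdual_norm_bound)
  fix x
  show "cmod (cdual_apply (dual_adj f) x) \<le> norm f * norm x"
    using cdual_norm[of f "adj x"] by (simp add: dual_adj.rep_eq norm_adj)
qed simp

lift_definition bidual_adj :: "'a::cstar_algebra bidual \<Rightarrow> 'a bidual"
  is "\<lambda>P f. cnj (cdual_apply P (dual_adj f))"
  subgoal for P
  proof (rule cbounded_linearI[where K="norm P"])
    fix f g :: "'a cdual" and c :: complex
    have "dual_adj (f + g) = dual_adj f + dual_adj g"
      by (rule cdual_eqI) (simp add: dual_adj.rep_eq plus_cdual.rep_eq)
    then show "cnj (cdual_apply P (dual_adj (f + g))) =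
        cnj (cdual_apply P (dual_adj f)) + cnj (cdual_apply P (dual_adj g))"
      by (simp add: cdual_add)
    have "dual_adj (c *\<^sub>C f) = cnj c *\<^sub>C dual_adj f"
      by (rule cdual_eqI) (simp add: dual_adj.rep_eq scaleC_cdual.rep_eq scaleC_complex_def)
    then show "cnj (cdual_apply P (dual_adj (c *\<^sub>C f))) = c *\<^sub>C cnj (cdual_apply P (dual_adj f))"
      by (simp add: cdual_scaleC scaleC_complex_def)
    show "cmod (cnj (cdual_apply P (dual_adj f))) \<le> norm f * norm P"
      using order_trans[OF cdual_norm[of P "dual_adj f"]
          mult_left_mono[OF norm_dual_adj[of f] norm_ge_zero[of P]]]
      by (simp add: algebra_simps)
  qed
  done

definition bidual_projection :: "'a::cstar_algebra bidual \<Rightarrow> bool"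
  where "bidual_projection p \<longleftrightarrow> p \<odot> p = p \<and> bidual_adj p = p"

definition bidual_proj_le :: "'a::cstar_algebra bidual \<Rightarrow> 'a bidual \<Rightarrow> bool"
  where "bidual_proj_le p q \<longleftrightarrow> p \<odot> q = p"

text \<open>
  \<open>is_proj_join S p\<close> says that \<open>p\<close> is the join in \<open>B**\<close> of the set \<open>S\<close> of projections,
  i.e. their supremum in the ordered set of projections of \<open>B**\<close>; the join of \<open>{}\<close> is \<open>0\<close>.
\<close>

definition is_proj_join :: "'a::cstar_algebra bidual set \<Rightarrow> 'a bidual \<Rightarrow> bool"
  where "is_proj_join S p \<longleftrightarrow>
    bidual_projection p \<and> (\<forall>q\<in>S. bidual_proj_le q p) \<and>
    (\<forall>p'. bidual_projection p' \<and> (\<forall>q\<in>S. bidual_proj_le q p') \<longrightarrow> bidual_proj_le p p')"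


section \<open>The multiplier algebra\<close>

text \<open>
  Multipliers are double centralizers \<open>(L, R)\<close>: the multiplier \<open>m\<close> is given by
  \<open>L b = m b\<close> and \<open>R b = b m\<close>.
\<close>

definition double_centralizer ::
    "('a::cstar_algebra \<Rightarrow> 'a) \<times> ('a \<Rightarrow> 'a) \<Rightarrow> bool"
  where "double_centralizer = (\<lambda>(L, R).
    cbounded_linear L \<and> cbounded_linear R \<and>
    (\<forall>a b. L (a * b) = L a * b) \<and> (\<forall>a b. R (a * b) = a * R b) \<and>
    (\<forall>a b. R a * b = a * L b))"

lemma cbounded_linear_0: "cbounded_linear (\<lambda>x::'a::cstar_algebra. 0::'a)"
  by (rule cbounded_linearI[where K=0]) (auto simp flip: norm_eq_zero simp: norm_scaleC)

typedef (overloaded) 'a multiplier =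
    "{m :: ('a::cstar_algebra \<Rightarrow> 'a) \<times> ('a \<Rightarrow> 'a). double_centralizer m}"
  by (rule exI[of _ "(\<lambda>x. 0, \<lambda>x. 0)"]) (simp add: double_centralizer_def cbounded_linear_0)

setup_lifting type_definition_multiplier

lift_definition lmul :: "'a::cstar_algebra multiplier \<Rightarrow> 'a \<Rightarrow> 'a" is fst .
lift_definition rmul :: "'a::cstar_algebra \<Rightarrow> 'a multiplier \<Rightarrow> 'a" is "\<lambda>b m. snd m b" .

lemma scaleC_diff_right: "c *\<^sub>C (x - y) = c *\<^sub>C x - c *\<^sub>C (y::'a::complex_normed_vector)"
  by (metis add_diff_cancel diff_add_cancel scaleC_add_right)

lemma scaleC_minus_right: "c *\<^sub>C (- x) = - (c *\<^sub>C (x::'a::complex_normed_vector))"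
  by (metis diff_0 diff_self scaleC_diff_right)

instantiation multiplier :: (cstar_algebra) "{ring, monoid_mult}"
begin

lift_definition zero_multiplier :: "'a multiplier" is "(\<lambda>b. 0, \<lambda>b. 0)"
  by (simp add: double_centralizer_def cbounded_linear_0)

lift_definition one_multiplier :: "'a multiplier" is "(\<lambda>b. b, \<lambda>b. b)"
  by (simp add: double_centralizer_def cbounded_linear_def)

lift_definition plus_multiplier :: "'a multiplier \<Rightarrow> 'a multiplier \<Rightarrow> 'a multiplier"
  is "\<lambda>(L, R) (L', R'). (\<lambda>b. L b + L' b, \<lambda>b. R b + R' b)"
  by (auto simp: double_centralizer_def cbounded_linear_def bounded_linear_add
      scaleC_add_right distrib_left distrib_right)

lift_definition minus_multiplier :: "'a multiplier \<Rightarrow> 'a multiplier \<Rightarrow> 'a multiplier"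
  is "\<lambda>(L, R) (L', R'). (\<lambda>b. L b - L' b, \<lambda>b. R b - R' b)"
  by (auto simp: double_centralizer_def cbounded_linear_def bounded_linear_sub
      scaleC_diff_right left_diff_distrib right_diff_distrib)

lift_definition uminus_multiplier :: "'a multiplier \<Rightarrow> 'a multiplier"
  is "\<lambda>(L, R). (\<lambda>b. - L b, \<lambda>b. - R b)"
  by (auto simp: double_centralizer_def cbounded_linear_def bounded_linear_minus
      scaleC_minus_right)

lift_definition times_multiplier :: "'a multiplier \<Rightarrow> 'a multiplier \<Rightarrow> 'a multiplier"
  is "\<lambda>(L, R) (L', R'). (\<lambda>b. L (L' b), \<lambda>b. R' (R b))"
  by (auto simp: double_centralizer_def cbounded_linear_def bounded_linear_compose[unfolded o_def])

instance
  by standard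
    (transfer, auto simp: fun_eq_iff double_centralizer_def cbounded_linear_def linear_simps
      algebra_simps)+

end

lift_definition to_multiplier :: "'a::cstar_algebra \<Rightarrow> 'a multiplier"
  is "\<lambda>x. (\<lambda>b. x * b, \<lambda>b. b * x)"
  by (auto simp: double_centralizer_def cbounded_linear_def mult_scaleC_left mult_scaleC_right
      mult.assoc bounded_linear_mult_left bounded_linear_mult_right)

definition strictly_tendsto ::
    "('i \<Rightarrow> 'a::cstar_algebra multiplier) \<Rightarrow> 'a multiplier \<Rightarrow> 'i filter \<Rightarrow> bool"
  where "strictly_tendsto f m X \<longleftrightarrow>
    (\<forall>b. ((\<lambda>i. lmul (f i) b) \<longlongrightarrow> lmul m b) X \<and> ((\<lambda>i. rmul b (f i)) \<longlongrightarrow> rmul b m) X)"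

text \<open>
  The graph of the canonical embedding \<open>M(B) \<subseteq> B**\<close> that extends \<open>B \<subseteq> B**\<close>: \<open>p\<close> is
  the image of \<open>m\<close> iff \<open>p b = m b\<close> and \<open>b p = b m\<close> for all \<open>b \<in> B\<close>. For each \<open>m\<close> there is
  exactly one such \<open>p\<close>.
\<close>

definition multiplier_in_bidual :: "'a::cstar_algebra multiplier \<Rightarrow> 'a bidual \<Rightarrow> bool"
  where "multiplier_in_bidual m p \<longleftrightarrow>
    (\<forall>b. p \<odot> to_bidual b = to_bidual (lmul m b) \<and> to_bidual b \<odot> p = to_bidual (rmul b m))"


section \<open>Left cancellative small categories\<close>

text \<open>A small category is identified with its set \<open>Mor C\<close> of morphisms, objects being identities.\<close>

record 'c small_cat =
  Mor :: "'c set"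
  Obj :: "'c set"
  rng :: "'c \<Rightarrow> 'c"
  src :: "'c \<Rightarrow> 'c"
  cat_comp :: "'c \<Rightarrow> 'c \<Rightarrow> 'c"

definition small_category :: "'c small_cat \<Rightarrow> bool"
  where "small_category C \<longleftrightarrow>
    Obj C \<subseteq> Mor C \<and> Obj C \<noteq> {} \<and>
    (\<forall>\<alpha>\<in>Mor C. rng C \<alpha> \<in> Obj C \<and> src C \<alpha> \<in> Obj C) \<and>
    (\<forall>v\<in>Obj C. rng C v = v \<and> src C v = v) \<and>
    (\<forall>\<alpha>\<in>Mor C. \<forall>\<beta>\<in>Mor C. src C \<alpha> = rng C \<beta> \<longrightarrow>
      cat_comp C \<alpha> \<beta> \<in> Mor C \<and> rng C (cat_comp C \<alpha> \<beta>) = rng C \<alpha> \<and> src C (cat_comp C \<alpha> \<beta>) = src C \<beta>) \<and>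
    (\<forall>\<alpha>\<in>Mor C. \<forall>\<beta>\<in>Mor C. \<forall>\<gamma>\<in>Mor C. src C \<alpha> = rng C \<beta> \<and> src C \<beta> = rng C \<gamma> \<longrightarrow>
      cat_comp C (cat_comp C \<alpha> \<beta>) \<gamma> = cat_comp C \<alpha> (cat_comp C \<beta> \<gamma>)) \<and>
    (\<forall>\<alpha>\<in>Mor C. cat_comp C (rng C \<alpha>) \<alpha> = \<alpha> \<and> cat_comp C \<alpha> (src C \<alpha>) = \<alpha>)"

definition left_cancellative :: "'c small_cat \<Rightarrow> bool"
  where "left_cancellative C \<longleftrightarrow>
    (\<forall>\<alpha>\<in>Mor C. \<forall>\<beta>\<in>Mor C. \<forall>\<gamma>\<in>Mor C.
      src C \<alpha> = rng C \<beta> \<and> src C \<alpha> = rng C \<gamma> \<and> cat_comp C \<alpha> \<beta> = cat_comp C \<alpha> \<gamma> \<longrightarrow> \<beta> = \<gamma>)"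

text \<open>
  \<open>\<alpha>C = {\<alpha>\<beta>. r(\<beta>) = s(\<alpha>)}\<close>. For an object \<open>v\<close> this is \<open>{\<beta>. r(\<beta>) = v}\<close>, so the notation
  \<open>vC\<close> is unambiguous.
\<close>

definition right_ideal :: "'c small_cat \<Rightarrow> 'c \<Rightarrow> 'c set"
  where "right_ideal C \<alpha> = {cat_comp C \<alpha> \<beta> | \<beta>. \<beta> \<in> Mor C \<and> rng C \<beta> = src C \<alpha>}"

lemma right_ideal_Obj:
  assumes "small_category C" "v \<in> Obj C"
  shows "right_ideal C v = {\<beta> \<in> Mor C. rng C \<beta> = v}"
  using assms unfolding small_category_def right_ideal_def by (safe; metis)

definition finitely_aligned :: "'c small_cat \<Rightarrow> bool"
  where "finitely_aligned C \<longleftrightarrow>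
    (\<forall>\<alpha>\<in>Mor C. \<forall>\<beta>\<in>Mor C. \<exists>F. finite F \<and> F \<subseteq> Mor C \<and>
      right_ideal C \<alpha> \<inter> right_ideal C \<beta> = (\<Union>\<gamma>\<in>F. right_ideal C \<gamma>))"

definition independent_set :: "'c small_cat \<Rightarrow> 'c set \<Rightarrow> bool"
  where "independent_set C F \<longleftrightarrow> (\<forall>\<gamma>\<in>F. \<forall>\<gamma>'\<in>F. \<gamma> \<noteq> \<gamma>' \<longrightarrow> \<gamma> \<notin> right_ideal C \<gamma>')"

text \<open>\<open>F\<close> is one of the possible choices of \<open>\<alpha> \<or> \<beta>\<close>.\<close>

definition is_vee :: "'c small_cat \<Rightarrow> 'c \<Rightarrow> 'c \<Rightarrow> 'c set \<Rightarrow> bool"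
  where "is_vee C \<alpha> \<beta> F \<longleftrightarrow>
    finite F \<and> F \<subseteq> Mor C \<and> independent_set C F \<and>
    right_ideal C \<alpha> \<inter> right_ideal C \<beta> = (\<Union>\<gamma>\<in>F. right_ideal C \<gamma>)"

definition exhaustive_at :: "'c small_cat \<Rightarrow> 'c \<Rightarrow> 'c set \<Rightarrow> bool"
  where "exhaustive_at C v F \<longleftrightarrow>
    F \<subseteq> right_ideal C v \<and>
    (\<forall>\<alpha>\<in>right_ideal C v. \<exists>\<beta>\<in>F. right_ideal C \<alpha> \<inter> right_ideal C \<beta> \<noteq> {})"

definition covering_of :: "'c small_cat \<Rightarrow> 'c set \<Rightarrow> 'c set \<Rightarrow> bool"
  where "covering_of C L H \<longleftrightarrow>
    H \<subseteq> L \<and> (\<forall>\<alpha>\<in>L. \<exists>\<beta>\<in>H. right_ideal C \<alpha> \<inter> right_ideal C \<beta> \<noteq> {})"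

definition cat_FK :: "'c small_cat \<Rightarrow> 'c set \<Rightarrow> 'c set \<Rightarrow> 'c set"
  where "cat_FK C F K =
    {\<alpha> \<in> Mor C. (\<forall>\<beta>\<in>F. \<alpha> \<in> right_ideal C (src C \<beta>)) \<and> (\<forall>\<gamma>\<in>K. \<alpha> \<notin> right_ideal C (src C \<gamma>))}"


section \<open>Representations\<close>

text \<open>Only the values of \<open>T\<close> on \<open>Mor C\<close> matter below.\<close>

abbreviation range_proj :: "('c \<Rightarrow> 'b::cstar_algebra) \<Rightarrow> 'c \<Rightarrow> 'b"
  where "range_proj T \<alpha> \<equiv> T \<alpha> * adj (T \<alpha>)"

abbreviation source_proj :: "('c \<Rightarrow> 'b::cstar_algebra) \<Rightarrow> 'c \<Rightarrow> 'b"
  where "source_proj T \<alpha> \<equiv> adj (T \<alpha>) * T \<alpha>"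

text \<open>
  The quantification over \<open>F\<close> expresses that the relation holds for \<open>\<alpha> \<or> \<beta>\<close>
  whichever choice is made for it. In a finitely aligned \<open>C\<close> a choice exists.
\<close>

definition cat_representation :: "'c small_cat \<Rightarrow> ('c \<Rightarrow> 'b::cstar_algebra) \<Rightarrow> bool"
  where "cat_representation C T \<longleftrightarrow>
    (\<forall>\<alpha>\<in>Mor C. source_proj T \<alpha> = T (src C \<alpha>)) \<and>
    (\<forall>\<alpha>\<in>Mor C. \<forall>\<beta>\<in>Mor C. src C \<alpha> = rng C \<beta> \<longrightarrow> T \<alpha> * T \<beta> = T (cat_comp C \<alpha> \<beta>)) \<and>
    (\<forall>\<alpha>\<in>Mor C. \<forall>\<beta>\<in>Mor C. \<forall>F. is_vee C \<alpha> \<beta> F \<longrightarrow>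
      is_proj_join ((\<lambda>\<gamma>. to_bidual (range_proj T \<gamma>)) ` F)
        (to_bidual (range_proj T \<alpha> * range_proj T \<beta>)))"

definition covariant :: "'c small_cat \<Rightarrow> ('c \<Rightarrow> 'b::cstar_algebra) \<Rightarrow> bool"
  where "covariant C T \<longleftrightarrow> cat_representation C T \<and>
    (\<forall>v\<in>Obj C. \<forall>F. finite F \<and> exhaustive_at C v F \<longrightarrow>
      is_proj_join ((\<lambda>\<alpha>. to_bidual (range_proj T \<alpha>)) ` F) (to_bidual (T v)))"

definition nondegenerate :: "'c small_cat \<Rightarrow> ('c \<Rightarrow> 'b::cstar_algebra) \<Rightarrow> bool"
  where "nondegenerate C T \<longleftrightarrow>
    strictly_tendsto (\<lambda>V. \<Sum>v\<in>V. to_multiplier (T v)) 1 (finite_subsets_at_top (Obj C))"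

text \<open>
  The equation in tightness holds in \<open>B**\<close>, its right hand side being an element of
  \<open>M(B) \<subseteq> B**\<close>. As \<open>M(B)\<close> is not commutative, the products over the finite sets \<open>F\<close> and \<open>K\<close>
  are formed along enumerations \<open>fs\<close> and \<open>ks\<close> without repetition; for a representation
  the factors commute, so the choice of the enumerations is irrelevant.
\<close>

definition tight :: "'c small_cat \<Rightarrow> ('c \<Rightarrow> 'b::cstar_algebra) \<Rightarrow> bool"
  where "tight C T \<longleftrightarrow>
    (\<forall>F K H fs ks.
      finite F \<and> F \<subseteq> Mor C \<and> finite K \<and> K \<subseteq> Mor C \<and>
      finite H \<and> covering_of C (cat_FK C F K) H \<and>
      distinct fs \<and> set fs = F \<and> distinct ks \<and> set ks = K \<longrightarrow>
      (\<exists>p. is_proj_join ((\<lambda>\<alpha>. to_bidual (range_proj T \<alpha>)) ` H) p \<and>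
        multiplier_in_bidual
          (prod_list (map (\<lambda>\<beta>. to_multiplier (source_proj T \<beta>)) fs) *
           prod_list (map (\<lambda>\<gamma>. 1 - to_multiplier (source_proj T \<gamma>)) ks)) p))"

end

theory Submission
  imports Defs
begin

text \<open>
  A source projection of \<open>T\<close> is \<open>T\<^sub>v\<close> for an object \<open>v\<close>, and distinct objects have disjoint right
  ideals, so the projections \<open>T\<^sub>v\<close> are pairwise orthogonal. Accordingly, the product in the
  tightness condition for \<open>F\<close> and \<open>K\<close> is the sum of the \<open>T\<^sub>v\<close> over the set \<open>V\<close> of objects that
  satisfy the constraints (\<open>v = s(\<beta>)\<close> for \<open>\<beta> \<in> F\<close>, \<open>v \<noteq> s(\<gamma>)\<close> for \<open>\<gamma> \<in> K\<close>), and the set of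
  morphisms to be covered is the disjoint union of the \<open>vC\<close> with \<open>v \<in> V\<close>. A covering
  of it is a family of exhaustive sets, one at each \<open>v \<in> V\<close>, so tightness for \<open>F, K\<close> is the
  sum over \<open>V\<close> of covariance at the single objects.

  If \<open>F = {v}\<close> and \<open>K = {}\<close>, then \<open>V = {v}\<close>; hence tightness implies covariance
  (\<open>tight_imp_covariant\<close>). For the converse the sum has to be finite, and it has to represent the
  product in the multiplier algebra. When \<open>F\<close> is nonempty, \<open>V\<close> has at most one element and the
  product is an element of \<open>B\<close>. When \<open>F\<close> is empty, the existence of a finite covering forces
  \<open>C\<close> to have only finitely many objects, since all but those in \<open>s(K)\<close> are ranges of
  members of the covering; nondegeneracy then reads \<open>1 = \<Sum>\<^sub>v T\<^sub>v\<close>, a finite sum, and the factors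
  \<open>1 - T\<^sub>w\<close> delete summands from it. The lemmas \<open>multiplier_source_product\<close> and
  \<open>join_of_covering\<close> treat the two sides of the tightness equation.

  Joins are formed in \<open>B**\<close>, so a join relation for elements of \<open>B\<close>, such as the orthogonality of
  the \<open>T\<^sub>v\<close>, says something about their images under the canonical map \<open>B \<rightarrow> B**\<close>. As this
  map is a homomorphism of involutive algebras and the two sides of the tightness equation are
  compared in \<open>B**\<close>, the identities below are stated and combined for these images.
\<close>

section \<open>The canonical map into the bidual\<close>

lemma to_bidual_add: "to_bidual (x + y) = to_bidual x + to_bidual y"
  by (rule cdual_eqI) (simp add: to_bidual.rep_eq plus_cdual.rep_eq cdual_add)

lemma to_bidual_0 [simp]: "to_bidual 0 = 0"
  using to_bidual_add[of 0 0] by simp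

lemma to_bidual_diff: "to_bidual (x - y) = to_bidual x - to_bidual y"
  using to_bidual_add[of "x - y" y] by simp

lemma to_bidual_sum: "to_bidual (\<Sum>i\<in>I. f i) = (\<Sum>i\<in>I. to_bidual (f i))"
  by (induction I rule: infinite_finite_induct) (simp_all add: to_bidual_add)

lemma to_bidual_mult: "to_bidual (x * y) = to_bidual x \<odot> to_bidual y"
  by (rule cdual_eqI)
    (simp add: to_bidual.rep_eq bidual_mult.rep_eq bidual_act.rep_eq dual_right_act.rep_eq)

lemma to_bidual_adj: "to_bidual (adj x) = bidual_adj (to_bidual x)"
  by (rule cdual_eqI) (simp add: to_bidual.rep_eq bidual_adj.rep_eq dual_adj.rep_eq)

lemma bidual_mult_add_left: "(P + Q) \<odot> R = P \<odot> R + Q \<odot> R"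
  by (rule cdual_eqI) (simp add: bidual_mult.rep_eq plus_cdual.rep_eq)

lemma bidual_mult_0_left [simp]: "0 \<odot> R = 0"
  using bidual_mult_add_left[of 0 0 R] by simp

lemma bidual_mult_sum_left: "(\<Sum>i\<in>I. P i) \<odot> R = (\<Sum>i\<in>I. P i \<odot> R)"
  by (induction I rule: infinite_finite_induct) (simp_all add: bidual_mult_add_left)

lemma cdual_0 [simp]: "cdual_apply P 0 = 0"
  using cdual_add[of P 0 0] by simp

lemma bidual_mult_0_right [simp]: "P \<odot> 0 = 0"
proof -
  have "bidual_act 0 f = 0" for f :: "'a cdual"
    by (rule cdual_eqI) (simp add: bidual_act.rep_eq zero_cdual.rep_eq)
  then show ?thesis
    by (intro cdual_eqI) (simp add: bidual_mult.rep_eq zero_cdual.rep_eq)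
qed

lemma adj_0 [simp]: "adj (0::'a::cstar_algebra) = 0"
  using adj_add[of "0::'a" 0] by simp

lemma adj_sum: "adj (\<Sum>i\<in>I. f i) = (\<Sum>i\<in>I. adj (f i :: 'a::cstar_algebra))"
  by (induction I rule: infinite_finite_induct) (simp_all add: adj_add)

lemma bidual_projection_0: "bidual_projection (0::'a::cstar_algebra bidual)"
  using to_bidual_adj[of "0::'a"] by (simp add: bidual_projection_def)

lemma proj_join_empty:
  assumes "is_proj_join {} p"
  shows "p = 0"
  using assms bidual_projection_0 by (auto simp: is_proj_join_def bidual_proj_le_def)

section \<open>Multipliers given by elements of the algebra\<close>

lemma lmul_to_multiplier: "lmul (to_multiplier x) b = x * b"
  by transfer simp

lemma rmul_to_multiplier: "rmul b (to_multiplier x) = b * x"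
  by transfer simp

lemma lmul_times: "lmul (m * n) b = lmul m (lmul n b)"
  by transfer (auto split: prod.splits)

lemma rmul_times: "rmul b (m * n) = rmul (rmul b m) n"
  by transfer (auto split: prod.splits)

lemma lmul_diff: "lmul (m - n) b = lmul m b - lmul n b"
  by transfer (auto split: prod.splits)

lemma rmul_diff: "rmul b (m - n) = rmul b m - rmul b n"
  by transfer (auto split: prod.splits)

lemma lmul_one: "lmul 1 b = b"
  by transfer simp

lemma rmul_one: "rmul b 1 = b"
  by transfer simp

lemma to_multiplier_add: "to_multiplier (x + y) = to_multiplier x + to_multiplier y"
  by transfer (simp add: fun_eq_iff algebra_simps)

lemma to_multiplier_sum:
  "(\<Sum>i\<in>I. to_multiplier (f i)) = to_multiplier (\<Sum>i\<in>I. f i)"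
proof -
  have "to_multiplier 0 = 0"
    using to_multiplier_add[of 0 0] by simp
  then show ?thesis
    by (induction I rule: infinite_finite_induct) (simp_all add: to_multiplier_add)
qed

lemma multiplier_in_bidual_to_multiplier:
  "multiplier_in_bidual (to_multiplier x) (to_bidual x)"
  by (simp add: multiplier_in_bidual_def lmul_to_multiplier rmul_to_multiplier to_bidual_mult)

lemma multiplier_in_bidual_times:
  assumes "multiplier_in_bidual m (to_bidual x)"
  shows "multiplier_in_bidual (m * to_multiplier a) (to_bidual (x * a))"
proof -
  have m: "to_bidual (x * b) = to_bidual (lmul m b)" "to_bidual (b * x) = to_bidual (rmul b m)" for b
    using assms unfolding multiplier_in_bidual_def to_bidual_mult by simp_all
  have "to_bidual (b * (x * a)) = to_bidual (rmul b m * a)" for b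
    using m(2)[of b] by (simp add: to_bidual_mult flip: mult.assoc)
  then show ?thesis
    using m(1) unfolding multiplier_in_bidual_def to_bidual_mult[symmetric]
    by (simp add: lmul_times rmul_times lmul_to_multiplier rmul_to_multiplier mult.assoc)
qed

lemma multiplier_in_bidual_diff:
  assumes "multiplier_in_bidual m (to_bidual x)" "multiplier_in_bidual n (to_bidual y)"
  shows "multiplier_in_bidual (m - n) (to_bidual (x - y))"
  using assms unfolding multiplier_in_bidual_def to_bidual_mult[symmetric]
  by (simp add: lmul_diff rmul_diff to_bidual_diff left_diff_distrib right_diff_distrib)

section \<open>The object projections of a representation\<close>

locale category_representation =
  fixes C :: "'c small_cat" and T :: "'c \<Rightarrow> 'b::cstar_algebra"
  assumes cat: "small_category C" and rep: "cat_representation C T"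
begin

lemma Obj_Mor: "v \<in> Obj C \<Longrightarrow> v \<in> Mor C"
  using cat unfolding small_category_def by blast

lemma rng_Obj: "v \<in> Obj C \<Longrightarrow> rng C v = v"
  using cat unfolding small_category_def by blast

lemma src_Obj: "v \<in> Obj C \<Longrightarrow> src C v = v"
  using cat unfolding small_category_def by blast

lemma rng_in_Obj: "\<alpha> \<in> Mor C \<Longrightarrow> rng C \<alpha> \<in> Obj C"
  using cat unfolding small_category_def by blast

lemma src_in_Obj: "\<alpha> \<in> Mor C \<Longrightarrow> src C \<alpha> \<in> Obj C"
  using cat unfolding small_category_def by blast

lemma rng_comp:
  "\<alpha> \<in> Mor C \<Longrightarrow> \<beta> \<in> Mor C \<Longrightarrow> src C \<alpha> = rng C \<beta> \<Longrightarrow> rng C (cat_comp C \<alpha> \<beta>) = rng C \<alpha>"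
  using cat unfolding small_category_def by blast

lemma rng_comp_self: "\<alpha> \<in> Mor C \<Longrightarrow> cat_comp C (rng C \<alpha>) \<alpha> = \<alpha>"
  using cat unfolding small_category_def by blast

lemma rng_right_ideal: "\<alpha> \<in> Mor C \<Longrightarrow> \<beta> \<in> right_ideal C \<alpha> \<Longrightarrow> rng C \<beta> = rng C \<alpha>"
  using rng_comp[of \<alpha>] by (auto simp: right_ideal_def)

lemma rng_eq_if_meet:
  assumes "\<alpha> \<in> Mor C" "\<beta> \<in> Mor C" "right_ideal C \<alpha> \<inter> right_ideal C \<beta> \<noteq> {}"
  shows "rng C \<alpha> = rng C \<beta>"
proof -
  obtain \<delta> where "\<delta> \<in> right_ideal C \<alpha>" "\<delta> \<in> right_ideal C \<beta>"
    using assms(3) by blast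
  then show ?thesis
    using rng_right_ideal[OF assms(1)] rng_right_ideal[OF assms(2)] by metis
qed

lemma source_proj: "\<alpha> \<in> Mor C \<Longrightarrow> source_proj T \<alpha> = T (src C \<alpha>)"
  using rep unfolding cat_representation_def by blast

lemma T_comp:
  "\<alpha> \<in> Mor C \<Longrightarrow> \<beta> \<in> Mor C \<Longrightarrow> src C \<alpha> = rng C \<beta> \<Longrightarrow> T \<alpha> * T \<beta> = T (cat_comp C \<alpha> \<beta>)"
  using rep unfolding cat_representation_def by blast

lemma proj_join_vee:
  "\<alpha> \<in> Mor C \<Longrightarrow> \<beta> \<in> Mor C \<Longrightarrow> is_vee C \<alpha> \<beta> F \<Longrightarrow>
    is_proj_join ((\<lambda>\<gamma>. to_bidual (range_proj T \<gamma>)) ` F)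
      (to_bidual (range_proj T \<alpha> * range_proj T \<beta>))"
  using rep unfolding cat_representation_def by blast

lemma adj_Obj: "v \<in> Obj C \<Longrightarrow> adj (T v) = T v"
proof -
  assume "v \<in> Obj C"
  then have eq: "source_proj T v = T v"
    using source_proj[of v] by (simp add: Obj_Mor src_Obj)
  then have "adj (T v) = adj (source_proj T v)"
    by simp
  also have "\<dots> = source_proj T v"
    by (simp only: adj_mult adj_adj)
  finally show "adj (T v) = T v"
    using eq by simp
qed

lemma idem_Obj:
  assumes "v \<in> Obj C"
  shows "T v * T v = T v"
  using source_proj[OF Obj_Mor[OF assms]] by (simp only: adj_Obj[OF assms] src_Obj[OF assms])

lemma rng_mult:
  assumes "\<alpha> \<in> Mor C"
  shows "T (rng C \<alpha>) * T \<alpha> = T \<alpha>"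
  using T_comp[OF Obj_Mor[OF rng_in_Obj[OF assms]] assms src_Obj[OF rng_in_Obj[OF assms]]]
  by (simp only: rng_comp_self[OF assms])

lemma range_proj_mult_rng: "\<alpha> \<in> Mor C \<Longrightarrow> range_proj T \<alpha> * T (rng C \<alpha>) = range_proj T \<alpha>"
  using arg_cong[OF rng_mult[of \<alpha>], of adj]
  by (simp only: adj_mult adj_Obj rng_in_Obj mult.assoc)

text \<open>
  Different objects have no common extension, so the empty set is an admissible choice of
  \<open>v \<or> w\<close>, and the empty join is \<open>0\<close>.
\<close>

lemma orthogonal_Obj:
  assumes "v \<in> Obj C" "w \<in> Obj C" "v \<noteq> w"
  shows "to_bidual (T v * T w) = 0"
proof -
  have "right_ideal C v \<inter> right_ideal C w = {}"
    using rng_eq_if_meet[OF assms(1,2)[THEN Obj_Mor]] assms(3)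
    unfolding rng_Obj[OF assms(1)] rng_Obj[OF assms(2)] by blast
  then have "is_vee C v w {}"
    by (simp add: is_vee_def independent_set_def)
  from proj_join_vee[OF assms(1,2)[THEN Obj_Mor] this]
  have "is_proj_join {} (to_bidual (range_proj T v * range_proj T w))"
    by simp
  from proj_join_empty[OF this] show ?thesis
    by (simp only: adj_Obj[OF assms(1)] adj_Obj[OF assms(2)] idem_Obj[OF assms(1)] idem_Obj[OF assms(2)])
qed

definition obj_sum :: "'c set \<Rightarrow> 'b"
  where "obj_sum V = (\<Sum>v\<in>V. T v)"

lemma obj_sum_times:
  assumes "finite V" "V \<subseteq> Obj C" "w \<in> Obj C"
  shows "to_bidual (obj_sum V * T w) = to_bidual (obj_sum (V \<inter> {w}))"
proof -
  have "to_bidual (obj_sum V * T w) = (\<Sum>v\<in>V. to_bidual (T v * T w))"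
    by (simp add: obj_sum_def sum_distrib_right to_bidual_sum)
  also have "\<dots> = (\<Sum>v\<in>V. if v \<in> {w} then to_bidual (T v) else 0)"
    using assms by (intro sum.cong refl) (auto simp: idem_Obj orthogonal_Obj)
  also have "\<dots> = to_bidual (obj_sum (V \<inter> {w}))"
    by (simp only: obj_sum_def to_bidual_sum
        sum.inter_restrict[OF assms(1), of "\<lambda>v. to_bidual (T v)"])
  finally show ?thesis .
qed

lemma times_obj_sum:
  assumes "finite V" "V \<subseteq> Obj C" "w \<in> V"
  shows "to_bidual (T w * obj_sum V) = to_bidual (T w)"
proof -
  have "to_bidual (T w * obj_sum V) = (\<Sum>v\<in>V. to_bidual (T w * T v))"
    by (simp add: obj_sum_def sum_distrib_left to_bidual_sum)
  also have "\<dots> = (\<Sum>v\<in>V. if v = w then to_bidual (T v) else 0)"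
    using assms subsetD[OF assms(2,3)]
    by (intro sum.cong refl) (auto simp: idem_Obj intro!: orthogonal_Obj)
  finally show ?thesis
    using assms by simp
qed

lemma projection_obj_sum:
  assumes "finite V" "V \<subseteq> Obj C"
  shows "bidual_projection (to_bidual (obj_sum V))"
proof -
  have "to_bidual (obj_sum V * obj_sum V) = (\<Sum>v\<in>V. to_bidual (T v * obj_sum V))"
    by (subst (1) obj_sum_def) (simp add: sum_distrib_right to_bidual_sum)
  also have "\<dots> = to_bidual (obj_sum V)"
    using times_obj_sum[OF assms] by (simp add: obj_sum_def to_bidual_sum)
  finally have "to_bidual (obj_sum V * obj_sum V) = to_bidual (obj_sum V)" .
  moreover have "adj (obj_sum V) = obj_sum V"
    using assms unfolding obj_sum_def adj_sum by (intro sum.cong refl) (auto simp: adj_Obj)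
  ultimately show ?thesis
    by (simp add: bidual_projection_def flip: to_bidual_mult to_bidual_adj)
qed

section \<open>The right-hand side of the tightness equation\<close>

text \<open>
  By orthogonality, multiplying by \<open>T\<^sub>w\<close> keeps from a sum of object projections only the summand
  at \<open>w\<close>, and multiplying by \<open>1 - T\<^sub>w\<close> removes that summand.
\<close>

lemma multiplier_times_source_list:
  assumes "finite V" "V \<subseteq> Obj C" "multiplier_in_bidual m (to_bidual (obj_sum V))"
    and "set fs \<subseteq> Mor C"
  shows "multiplier_in_bidual (m * prod_list (map (\<lambda>\<beta>. to_multiplier (source_proj T \<beta>)) fs))
    (to_bidual (obj_sum {v \<in> V. \<forall>\<beta>\<in>set fs. src C \<beta> = v}))"
  using assms
proof (induction fs arbitrary: m V)
  case (Cons \<beta> fs)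
  let ?W = "V \<inter> {src C \<beta>}"
  have "multiplier_in_bidual (m * to_multiplier (source_proj T \<beta>)) (to_bidual (obj_sum ?W))"
    using multiplier_in_bidual_times[OF Cons.prems(3), of "T (src C \<beta>)"]
      obj_sum_times[of V "src C \<beta>"] Cons.prems source_proj src_in_Obj by simp
  then have "multiplier_in_bidual (m * to_multiplier (source_proj T \<beta>) *
      prod_list (map (\<lambda>\<beta>. to_multiplier (source_proj T \<beta>)) fs))
      (to_bidual (obj_sum {v \<in> ?W. \<forall>\<beta>\<in>set fs. src C \<beta> = v}))"
    using Cons.prems by (intro Cons.IH) auto
  moreover have "{v \<in> ?W. \<forall>\<beta>\<in>set fs. src C \<beta> = v} = {v \<in> V. \<forall>\<beta>\<in>set (\<beta> # fs). src C \<beta> = v}"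
    by auto
  ultimately show ?case
    by (simp only: list.map prod_list.Cons mult.assoc)
qed simp

lemma multiplier_times_cosource_list:
  assumes "finite V" "V \<subseteq> Obj C" "multiplier_in_bidual m (to_bidual (obj_sum V))"
    and "set ks \<subseteq> Mor C"
  shows "multiplier_in_bidual
    (m * prod_list (map (\<lambda>\<gamma>. 1 - to_multiplier (source_proj T \<gamma>)) ks))
    (to_bidual (obj_sum (V - src C ` set ks)))"
  using assms
proof (induction ks arbitrary: m V)
  case (Cons \<gamma> ks)
  let ?w = "src C \<gamma>"
  have "obj_sum V = obj_sum (V \<inter> {?w}) + obj_sum (V - {?w})"
    using Cons.prems(1) unfolding obj_sum_def by (rule sum.Int_Diff)
  then have "to_bidual (obj_sum V - obj_sum V * T ?w) = to_bidual (obj_sum (V - {?w}))"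
    using obj_sum_times[of V ?w] Cons.prems src_in_Obj by (simp add: to_bidual_diff to_bidual_add)
  then have "multiplier_in_bidual (m * (1 - to_multiplier (source_proj T \<gamma>)))
      (to_bidual (obj_sum (V - {?w})))"
    using multiplier_in_bidual_diff[OF Cons.prems(3)
        multiplier_in_bidual_times[OF Cons.prems(3), of "T ?w"]]
      Cons.prems source_proj by (simp add: right_diff_distrib)
  then have "multiplier_in_bidual (m * (1 - to_multiplier (source_proj T \<gamma>)) *
      prod_list (map (\<lambda>\<gamma>. 1 - to_multiplier (source_proj T \<gamma>)) ks))
      (to_bidual (obj_sum (V - {?w} - src C ` set ks)))"
    using Cons.prems by (intro Cons.IH) auto
  moreover have "V - {?w} - src C ` set ks = V - src C ` set (\<gamma> # ks)"
    by auto
  ultimately show ?case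
    by (simp only: list.map prod_list.Cons mult.assoc)
qed simp

definition FK_objects :: "'c set \<Rightarrow> 'c set \<Rightarrow> 'c set"
  where "FK_objects F K = {v \<in> Obj C. \<forall>\<beta>\<in>F. src C \<beta> = v} - src C ` K"

lemma cat_FK_eq:
  assumes "F \<subseteq> Mor C" "K \<subseteq> Mor C"
  shows "cat_FK C F K = {\<alpha> \<in> Mor C. rng C \<alpha> \<in> FK_objects F K}"
proof -
  have "\<alpha> \<in> right_ideal C (src C \<beta>) \<longleftrightarrow> rng C \<alpha> = src C \<beta>" if "\<alpha> \<in> Mor C" "\<beta> \<in> Mor C" for \<alpha> \<beta>
    using that by (simp add: right_ideal_Obj[OF cat src_in_Obj])
  then have "(\<forall>\<beta>\<in>F. \<alpha> \<in> right_ideal C (src C \<beta>)) \<longleftrightarrow> (\<forall>\<beta>\<in>F. src C \<beta> = rng C \<alpha>)"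
    and "(\<forall>\<gamma>\<in>K. \<alpha> \<notin> right_ideal C (src C \<gamma>)) \<longleftrightarrow> rng C \<alpha> \<notin> src C ` K"
    if "\<alpha> \<in> Mor C" for \<alpha>
    using that assms by (auto simp: subset_iff)
  then have "\<alpha> \<in> cat_FK C F K \<longleftrightarrow> \<alpha> \<in> Mor C \<and> rng C \<alpha> \<in> FK_objects F K" for \<alpha>
    unfolding cat_FK_def FK_objects_def
    by (cases "\<alpha> \<in> Mor C") (simp_all only: mem_Collect_eq Diff_iff rng_in_Obj simp_thms)
  then show ?thesis
    by blast
qed

text \<open>
  With finitely many objects the strict limit in the definition of nondegeneracy is attained.
\<close>

lemma one_eq_obj_sum:
  assumes "nondegenerate C T" "finite (Obj C)"
  shows "multiplier_in_bidual 1 (to_bidual (obj_sum (Obj C)))"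
proof -
  have eq: "f (Obj C) = x" if "(f \<longlongrightarrow> x) (principal {Obj C})" for f and x :: 'b
    using tendsto_unique[OF _ tendsto_principal_singleton that]
    by (simp add: principal_eq_bot_iff)
  have lim: "((\<lambda>V. obj_sum V * b) \<longlongrightarrow> b) (principal {Obj C})"
    "((\<lambda>V. b * obj_sum V) \<longlongrightarrow> b) (principal {Obj C})" for b
    using assms
    by (simp_all add: nondegenerate_def strictly_tendsto_def finite_subsets_at_top_finite
        to_multiplier_sum lmul_to_multiplier rmul_to_multiplier lmul_one rmul_one obj_sum_def)
  have "obj_sum (Obj C) * b = b" "b * obj_sum (Obj C) = b" for b
    using eq[OF lim(1)] eq[OF lim(2)] by simp_all
  then show ?thesis
    by (simp add: multiplier_in_bidual_def lmul_one rmul_one flip: to_bidual_mult)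
qed

text \<open>
  For nonempty \<open>F\<close> the first factor of the product is an element \<open>T\<^sub>v\<close> of \<open>B\<close>, which starts the
  computation; for empty \<open>F\<close> it starts with the unit, written as the sum over all
  objects.
\<close>

lemma multiplier_source_product:
  assumes "set fs \<subseteq> Mor C" "set ks \<subseteq> Mor C"
    and "fs = [] \<Longrightarrow> nondegenerate C T \<and> finite (Obj C)"
  shows "multiplier_in_bidual
    (prod_list (map (\<lambda>\<beta>. to_multiplier (source_proj T \<beta>)) fs) *
      prod_list (map (\<lambda>\<gamma>. 1 - to_multiplier (source_proj T \<gamma>)) ks))
    (to_bidual (obj_sum (FK_objects (set fs) (set ks))))"
proof (cases fs)
  case Nil
  have "multiplier_in_bidual 1 (to_bidual (obj_sum (Obj C)))"
    using assms(3) Nil one_eq_obj_sum by blast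
  from multiplier_times_cosource_list[OF _ _ this assms(2)] show ?thesis
    using assms(3) Nil by (simp add: FK_objects_def)
next
  case (Cons \<beta> fs')
  let ?v = "src C \<beta>" and ?V = "{w \<in> {src C \<beta>}. \<forall>\<beta>'\<in>set fs'. src C \<beta>' = w}"
  have v: "?v \<in> Obj C" and \<beta>: "\<beta> \<in> Mor C"
    using assms Cons src_in_Obj by auto
  have "multiplier_in_bidual (to_multiplier (source_proj T \<beta>)) (to_bidual (obj_sum {?v}))"
    using source_proj[OF \<beta>] multiplier_in_bidual_to_multiplier by (simp add: obj_sum_def)
  then have "multiplier_in_bidual (to_multiplier (source_proj T \<beta>) *
      prod_list (map (\<lambda>\<beta>. to_multiplier (source_proj T \<beta>)) fs')) (to_bidual (obj_sum ?V))"
    using v assms Cons by (intro multiplier_times_source_list) auto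
  then have "multiplier_in_bidual (prod_list (map (\<lambda>\<beta>. to_multiplier (source_proj T \<beta>)) fs) *
      prod_list (map (\<lambda>\<gamma>. 1 - to_multiplier (source_proj T \<gamma>)) ks))
      (to_bidual (obj_sum (?V - src C ` set ks)))"
    using v assms(2) unfolding Cons
    by (intro multiplier_times_cosource_list) auto
  moreover have "?V - src C ` set ks = FK_objects (set fs) (set ks)"
    using v by (auto simp: FK_objects_def Cons)
  ultimately show ?thesis
    by simp
qed

section \<open>The left-hand side of the tightness equation\<close>

lemma covering_rng_surj:
  assumes "V \<subseteq> Obj C" "covering_of C {\<alpha> \<in> Mor C. rng C \<alpha> \<in> V} H"
  shows "V \<subseteq> rng C ` H"
proof
  fix v assume v: "v \<in> V"
  then have v': "v \<in> Mor C" "rng C v = v"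
    using assms(1) Obj_Mor rng_Obj by auto
  have "\<exists>\<beta>\<in>H. right_ideal C v \<inter> right_ideal C \<beta> \<noteq> {}"
    using assms(2) v v' unfolding covering_of_def by simp
  then obtain \<beta> where "\<beta> \<in> H" "\<beta> \<in> Mor C" "right_ideal C v \<inter> right_ideal C \<beta> \<noteq> {}"
    using assms(2) unfolding covering_of_def by blast
  then show "v \<in> rng C ` H"
    using v' rng_eq_if_meet[of v \<beta>] by auto
qed

text \<open>
  The members of the covering with range \<open>v\<close> are exhaustive at \<open>v\<close>, because a morphism
  that meets an element of \<open>vC\<close> has range \<open>v\<close> itself.
\<close>

lemma exhaustive_part_of_covering:
  assumes "V \<subseteq> Obj C" "covering_of C {\<alpha> \<in> Mor C. rng C \<alpha> \<in> V} H" "v \<in> V"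
  shows "exhaustive_at C v {\<alpha> \<in> H. rng C \<alpha> = v}"
proof -
  have vC: "right_ideal C v = {\<beta> \<in> Mor C. rng C \<beta> = v}"
    using assms right_ideal_Obj[OF cat] by blast
  have H: "H \<subseteq> Mor C"
    using assms unfolding covering_of_def by blast
  have "\<exists>\<beta>\<in>{\<alpha> \<in> H. rng C \<alpha> = v}. right_ideal C \<alpha> \<inter> right_ideal C \<beta> \<noteq> {}"
    if \<alpha>: "\<alpha> \<in> Mor C" "rng C \<alpha> = v" for \<alpha>
  proof -
    obtain \<beta> where \<beta>: "\<beta> \<in> H" "right_ideal C \<alpha> \<inter> right_ideal C \<beta> \<noteq> {}"
      using assms \<alpha> unfolding covering_of_def by blast
    then have "rng C \<beta> = v"
      using rng_eq_if_meet[of \<alpha> \<beta>] \<alpha> H by auto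
    with \<beta> show ?thesis
      by blast
  qed
  then show ?thesis
    using H unfolding exhaustive_at_def vC by blast
qed

text \<open>
  A projection that dominates the range projections of the covering dominates, by
  covariance at each \<open>v \<in> V\<close>, all \<open>T\<^sub>v\<close>, and hence their orthogonal sum.
\<close>

lemma join_of_covering:
  assumes cov: "covariant C T" and V: "finite V" "V \<subseteq> Obj C"
    and H: "finite H" "covering_of C {\<alpha> \<in> Mor C. rng C \<alpha> \<in> V} H"
  shows "is_proj_join ((\<lambda>\<alpha>. to_bidual (range_proj T \<alpha>)) ` H) (to_bidual (obj_sum V))"
  unfolding is_proj_join_def
proof (intro conjI ballI allI impI)
  show "bidual_projection (to_bidual (obj_sum V))"
    using V by (rule projection_obj_sum)
next
  fix q assume "q \<in> (\<lambda>\<alpha>. to_bidual (range_proj T \<alpha>)) ` H"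
  then obtain \<alpha> where \<alpha>: "\<alpha> \<in> Mor C" "rng C \<alpha> \<in> V" and q: "q = to_bidual (range_proj T \<alpha>)"
    using H(2) unfolding covering_of_def by blast
  have "q \<odot> to_bidual (obj_sum V) = to_bidual (range_proj T \<alpha> * T (rng C \<alpha>) * obj_sum V)"
    by (simp only: q to_bidual_mult[symmetric] range_proj_mult_rng[OF \<alpha>(1)])
  also have "\<dots> = to_bidual (range_proj T \<alpha>) \<odot> to_bidual (T (rng C \<alpha>) * obj_sum V)"
    by (simp only: mult.assoc[of "range_proj T \<alpha>"] to_bidual_mult[of "range_proj T \<alpha>"])
  also have "\<dots> = q"
    unfolding times_obj_sum[OF V \<alpha>(2)] q
    by (simp only: to_bidual_mult[symmetric] range_proj_mult_rng[OF \<alpha>(1)])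
  finally show "bidual_proj_le q (to_bidual (obj_sum V))"
    by (simp add: bidual_proj_le_def)
next
  fix p' assume p': "bidual_projection p' \<and>
    (\<forall>q\<in>(\<lambda>\<alpha>. to_bidual (range_proj T \<alpha>)) ` H. bidual_proj_le q p')"
  have "to_bidual (T v) \<odot> p' = to_bidual (T v)" if "v \<in> V" for v
  proof -
    have "is_proj_join ((\<lambda>\<alpha>. to_bidual (range_proj T \<alpha>)) ` {\<alpha> \<in> H. rng C \<alpha> = v}) (to_bidual (T v))"
      using cov exhaustive_part_of_covering[OF V(2) H(2) that] H(1) V(2) that
      unfolding covariant_def by auto
    then show ?thesis
      using p' unfolding is_proj_join_def bidual_proj_le_def by blast
  qed
  then show "bidual_proj_le (to_bidual (obj_sum V)) p'"
    by (simp add: bidual_proj_le_def obj_sum_def to_bidual_sum bidual_mult_sum_left)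
qed

section \<open>Tightness and covariance\<close>

text \<open>
  Tightness for \<open>F = {v}\<close> and \<open>K = {}\<close> provides a join \<open>p\<close> which acts on \<open>B\<close> as \<open>T\<^sub>v\<close>. That \<open>p\<close> is
  \<open>T\<^sub>v\<close> itself is seen by letting it act on \<open>T\<^sub>v\<close>: this gives \<open>p \<odot> T\<^sub>v = T\<^sub>v\<close>, while \<open>p \<le> T\<^sub>v\<close> as
  \<open>T\<^sub>v\<close> is an upper bound.
\<close>

lemma tight_imp_covariant:
  assumes "tight C T"
  shows "covariant C T"
proof -
  have "is_proj_join ((\<lambda>\<alpha>. to_bidual (range_proj T \<alpha>)) ` F) (to_bidual (T v))"
    if v: "v \<in> Obj C" and F: "finite F" "exhaustive_at C v F" for v F
  proof -
    have vC: "right_ideal C v = {\<beta> \<in> Mor C. rng C \<beta> = v}"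
      using v right_ideal_Obj[OF cat] by blast
    have "FK_objects {v} {} = {v}"
      using v src_Obj by (auto simp: FK_objects_def)
    then have "cat_FK C {v} {} = right_ideal C v"
      using cat_FK_eq[of "{v}" "{}"] v Obj_Mor by (simp add: vC)
    then have "covering_of C (cat_FK C {v} {}) F"
      using F by (simp add: covering_of_def exhaustive_at_def)
    then have "\<exists>p. is_proj_join ((\<lambda>\<alpha>. to_bidual (range_proj T \<alpha>)) ` F) p \<and>
        multiplier_in_bidual (prod_list (map (\<lambda>\<beta>. to_multiplier (source_proj T \<beta>)) [v]) *
          prod_list (map (\<lambda>\<gamma>. 1 - to_multiplier (source_proj T \<gamma>)) [])) p"
      using assms[unfolded tight_def, rule_format, of "{v}" "{}" F "[v]" "[]"] F v Obj_Mor by simp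
    then obtain p where p: "is_proj_join ((\<lambda>\<alpha>. to_bidual (range_proj T \<alpha>)) ` F) p"
      "multiplier_in_bidual (to_multiplier (T v)) p"
      using source_proj v Obj_Mor src_Obj by auto
    have "p \<odot> to_bidual (T v) = to_bidual (T v)"
      using p(2) v by (simp add: multiplier_in_bidual_def lmul_to_multiplier idem_Obj)
    moreover have "bidual_projection (to_bidual (T v))"
      using projection_obj_sum[of "{v}"] v by (simp add: obj_sum_def)
    moreover have "bidual_proj_le (to_bidual (range_proj T \<alpha>)) (to_bidual (T v))" if "\<alpha> \<in> F" for \<alpha>
      using that F range_proj_mult_rng[of \<alpha>]
      by (auto simp: bidual_proj_le_def exhaustive_at_def vC simp flip: to_bidual_mult)
    ultimately have "p = to_bidual (T v)"
      using p(1) unfolding is_proj_join_def by (auto simp: bidual_proj_le_def)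
    with p(1) show ?thesis
      by simp
  qed
  then show ?thesis
    using rep by (simp add: covariant_def)
qed

lemma covariant_imp_tight:
  assumes nd: "nondegenerate C T" and cov: "covariant C T"
  shows "tight C T"
  unfolding tight_def
proof (intro allI impI)
  fix F K H fs ks
  assume *: "finite F \<and> F \<subseteq> Mor C \<and> finite K \<and> K \<subseteq> Mor C \<and>
      finite H \<and> covering_of C (cat_FK C F K) H \<and>
      distinct fs \<and> set fs = F \<and> distinct ks \<and> set ks = K"
  let ?V = "FK_objects F K"
  have V: "?V \<subseteq> Obj C"
    by (auto simp: FK_objects_def)
  have H: "covering_of C {\<alpha> \<in> Mor C. rng C \<alpha> \<in> ?V} H"
    using * cat_FK_eq[of F K] by simp
  have finV: "finite ?V"
    using covering_rng_surj[OF V H] * by (meson finite_imageI finite_subset)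
  have "finite (Obj C)" if "fs = []"
  proof -
    have "Obj C \<subseteq> ?V \<union> src C ` K"
      using that * by (auto simp: FK_objects_def)
    with finV * show ?thesis
      by (meson finite_Un finite_imageI finite_subset)
  qed
  then have "multiplier_in_bidual
      (prod_list (map (\<lambda>\<beta>. to_multiplier (source_proj T \<beta>)) fs) *
       prod_list (map (\<lambda>\<gamma>. 1 - to_multiplier (source_proj T \<gamma>)) ks)) (to_bidual (obj_sum ?V))"
    using multiplier_source_product[of fs ks] nd * by blast
  moreover have "is_proj_join ((\<lambda>\<alpha>. to_bidual (range_proj T \<alpha>)) ` H) (to_bidual (obj_sum ?V))"
    using * by (intro join_of_covering cov finV V H) simp
  ultimately show "\<exists>p. is_proj_join ((\<lambda>\<alpha>. to_bidual (range_proj T \<alpha>)) ` H) p \<and>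
        multiplier_in_bidual
          (prod_list (map (\<lambda>\<beta>. to_multiplier (source_proj T \<beta>)) fs) *
           prod_list (map (\<lambda>\<gamma>. 1 - to_multiplier (source_proj T \<gamma>)) ks)) p"
    by blast
qed

end

theorem theorem3p17:
  fixes C :: "'c small_cat" and T :: "'c \<Rightarrow> 'b::cstar_algebra"
  assumes "small_category C" and "left_cancellative C" and "finitely_aligned C"
    and "cat_representation C T"
  shows "(tight C T \<longrightarrow> covariant C T) \<and> (nondegenerate C T \<and> covariant C T \<longrightarrow> tight C T)"
proof -
  interpret category_representation C T
    using assms by unfold_locales
  show ?thesis
    using tight_imp_covariant covariant_imp_tight by blast
qed

end
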